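(* Let $n\ge2$, $m=\lceil n/2\rceil$, $r=n-m=\lfloor n/2\rfloor$. Let $C\in\mathbb R^{n\times r}$ be given by $C_{kj}=k^j$ ($k=1,\dots,n$, $j=1,\dots,r$), let $C_{\rm top}\in\mathbb R^{r\times r}$ be its first $r$ rows (a nonsingular matrix) and $C_{\rm bot}\in\mathbb R^{m\times r}$ its last $m$ rows, and set $$A=\begin{pmatrix}-C_{\rm bot}C_{\rm top}^{-1}&I_m\end{pmatrix}\in\mathbb R^{m\times n}.$$ Then $$\operatorname{sd}(\mathcal R(A))=r=\left\lfloor\frac n2\right\rfloor .$$
   Context: $\mathbb S^p$ is the space of real symmetric $p\times p$ matrices with inner product $\langle X,Y\rangle=\operatorname{tr}(XY)$, and $\mathbb S^p_+$ is the positive semidefinite cone. Matrices in $\mathbb S^{n+1}$ have rows and columns indexed by $0,1,\dots,n$. For $A\in\mathbb R^{m\times n}$, $$\mathcal R(A)=\left\{Y=\begin{pmatrix} 1 & x^T \\ x & X \end{pmatrix}\in\mathbb S^{n+1}_+ : \operatorname{diag}(X)=x,\ Ax=0,\ AX=0\right\}=L\cap\mathbb S^{n+1}_+,$$ where $L\subseteq\mathbb S^{n+1}$ is the affine subspace defined by $Y_{00}=1$, $Y_{ii}=Y_{0i}$ ($i=1,\dots,n$) and $\begin{pmatrix}0&A\end{pmatrix}Y=0$. Singularity degree: for a set $S$, $S^\perp=\{z:\langle z,s\rangle=0\ \forall s\in S\}$; for a cone $K$, $K^*=\{z:\langle z,x\rangle\ge0\ \forall x\in K\}$. Let $L\subseteq\mathbb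 S^p$ be an affine subspace with $L\cap\mathbb S^p_+\ne\emptyset$ and let $F_{\min}$ be the minimal face of $\mathbb S^p_+$ containing $L\cap\mathbb S^p_+$. A facial-reduction sequence of length $d\ge0$ consists of faces $F_0=\mathbb S^p_+,F_1,\dots,F_d$ and matrices $W_j\in L^\perp\cap(F_{j-1}^*\setminus F_{j-1}^\perp)$ with $F_j=F_{j-1}\cap W_j^\perp$ ($j=1,\dots,d$), and $F_d=F_{\min}$. The singularity degree $\operatorname{sd}(L\cap\mathbb S^p_+)$ is the minimum length of a facial-reduction sequence; it is taken with respect to the affine subspace $L$ given by the defining equality constraints. *)

theory Defs
  imports
    Complex_Main
    "HOL-Library.Extended_Nat"
    "Jordan_Normal_Form.Matrix"
    "Jordan_Normal_Form.Gauss_Jordan_Elimination"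
begin

definition mat_trace :: "real mat \<Rightarrow> real" where
  "mat_trace X = (\<Sum>i<dim_row X. X $$ (i, i))"

definition mat_inner :: "real mat \<Rightarrow> real mat \<Rightarrow> real" where
  "mat_inner X Y = mat_trace (X * Y)"

definition sym_mats :: "nat \<Rightarrow> real mat set" where
  "sym_mats p = {X \<in> carrier_mat p p. transpose_mat X = X}"

definition psd_cone :: "nat \<Rightarrow> real mat set" where
  "psd_cone p = {X \<in> sym_mats p. \<forall>v \<in> carrier_vec p. 0 \<le> v \<bullet> (X *\<^sub>v v)}"

text \<open>Annihilators and dual cones are taken inside the space of symmetric matrices.
  The annihilator of an affine set consists of the matrices orthogonal to all of its points,
  not merely to its directions.\<close>

definition orth :: "nat \<Rightarrow> real mat set \<Rightarrow> real mat set" where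
  "orth p S = {Z \<in> sym_mats p. \<forall>s \<in> S. mat_inner Z s = 0}"

definition dual_cone :: "nat \<Rightarrow> real mat set \<Rightarrow> real mat set" where
  "dual_cone p K = {Z \<in> sym_mats p. \<forall>x \<in> K. 0 \<le> mat_inner Z x}"

text \<open>Convexity and faces are spelled out because matrices with variable dimensions do not form an
  instance of the class \<^class>\<open>real_vector\<close>; the definition of a face follows \<open>face_of\<close> of HOL-Analysis.\<close>

definition mat_convex :: "real mat set \<Rightarrow> bool" where
  "mat_convex S \<longleftrightarrow>
     (\<forall>X \<in> S. \<forall>Y \<in> S. \<forall>t. 0 \<le> t \<and> t \<le> 1 \<longrightarrow> (1 - t) \<cdot>\<^sub>m X + t \<cdot>\<^sub>m Y \<in> S)"

definition mat_face_of :: "real mat set \<Rightarrow> real mat set \<Rightarrow> bool" where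
  "mat_face_of F K \<longleftrightarrow> F \<subseteq> K \<and> mat_convex F \<and>
     (\<forall>X \<in> K. \<forall>Y \<in> K. \<forall>t. 0 < t \<and> t < 1 \<and> (1 - t) \<cdot>\<^sub>m X + t \<cdot>\<^sub>m Y \<in> F \<longrightarrow> X \<in> F \<and> Y \<in> F)"

text \<open>An intersection of faces is a face, so this is the least face containing \<open>L \<inter> psd_cone p\<close>.\<close>

definition min_face :: "nat \<Rightarrow> real mat set \<Rightarrow> real mat set" where
  "min_face p L = \<Inter> {F. mat_face_of F (psd_cone p) \<and> L \<inter> psd_cone p \<subseteq> F}"

definition facial_reduction_seq ::
  "nat \<Rightarrow> real mat set \<Rightarrow> nat \<Rightarrow> (nat \<Rightarrow> real mat set) \<Rightarrow> (nat \<Rightarrow> real mat) \<Rightarrow> bool" where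
  "facial_reduction_seq p L d F W \<longleftrightarrow>
     F 0 = psd_cone p \<and>
     (\<forall>j \<in> {1..d}.
        mat_face_of (F j) (psd_cone p) \<and>
        W j \<in> orth p L \<inter> (dual_cone p (F (j - 1)) - orth p (F (j - 1))) \<and>
        F j = F (j - 1) \<inter> orth p {W j}) \<and>
     F d = min_face p L"

text \<open>The infimum of a nonempty subset of \<^typ>\<open>enat\<close> is attained; the value is \<open>\<infinity>\<close> only if there is no
  facial reduction sequence.\<close>

definition singularity_degree :: "nat \<Rightarrow> real mat set \<Rightarrow> enat" where
  "singularity_degree p L = Inf {enat d |d. \<exists>F W. facial_reduction_seq p L d F W}"

text \<open>Column analogue of \<^const>\<open>append_rows\<close>.\<close>

definition append_cols :: "'a :: zero mat \<Rightarrow> 'a mat \<Rightarrow> 'a mat" where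
  "append_cols A B = four_block_mat A B (0\<^sub>m 0 (dim_col A)) (0\<^sub>m 0 (dim_col B))"

definition relaxation :: "real mat \<Rightarrow> real mat set" where
  "relaxation A =
     (let m = dim_row A; n = dim_col A in
      {Y \<in> psd_cone (n + 1).
         \<exists>x \<in> carrier_vec n. \<exists>X \<in> carrier_mat n n.
           Y = four_block_mat (1\<^sub>m 1) (mat_of_row x) (transpose_mat (mat_of_row x)) X \<and>
           (\<forall>i < n. X $$ (i, i) = x $ i) \<and>
           A *\<^sub>v x = 0\<^sub>v m \<and> A * X = 0\<^sub>m m n})"

definition relaxation_affine :: "real mat \<Rightarrow> real mat set" where
  "relaxation_affine A =
     (let m = dim_row A; n = dim_col A in
      {Y \<in> sym_mats (n + 1).
         Y $$ (0, 0) = 1 \<and>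
         (\<forall>i \<in> {1..n}. Y $$ (i, i) = Y $$ (0, i)) \<and>
         append_cols (0\<^sub>m m 1) A * Y = 0\<^sub>m m (n + 1)})"

lemma append_cols_zero_mult:
  fixes A Y :: "real mat"
  assumes A: "A \<in> carrier_mat m n" and Y: "Y \<in> carrier_mat (n + 1) c"
    and i: "i < m" and j: "j < c"
  shows "(append_cols (0\<^sub>m m 1) A * Y) $$ (i, j) = (\<Sum>k<n. A $$ (i, k) * Y $$ (Suc k, j))"
proof -
  have "(append_cols (0\<^sub>m m 1) A * Y) $$ (i, j)
      = (\<Sum>k<Suc n. (if k = 0 then 0 else A $$ (i, k - 1)) * Y $$ (k, j))"
    using A Y i j unfolding append_cols_def
    by (auto simp: scalar_prod_def lessThan_atLeast0 intro!: sum.cong)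
  also have "\<dots> = (\<Sum>k<n. A $$ (i, k) * Y $$ (Suc k, j))"
    by (subst sum.lessThan_Suc_shift) simp
  finally show ?thesis .
qed

lemma relaxation_eq: "relaxation A = relaxation_affine A \<inter> psd_cone (dim_col A + 1)"
proof -
  define m n where mn: "m = dim_row A" "n = dim_col A"
  have A: "A \<in> carrier_mat m n" by (auto simp: mn)
  show ?thesis
  proof (intro equalityI subsetI IntI)
    fix Y assume "Y \<in> relaxation A"
    then obtain x X where Yp: "Y \<in> psd_cone (n + 1)" and x: "x \<in> carrier_vec n"
      and X: "X \<in> carrier_mat n n"
      and Y: "Y = four_block_mat (1\<^sub>m 1) (mat_of_row x) (transpose_mat (mat_of_row x)) X"
      and d: "\<forall>i < n. X $$ (i, i) = x $ i"
      and Ax: "A *\<^sub>v x = 0\<^sub>v m" and AX: "A * X = 0\<^sub>m m n"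
      unfolding relaxation_def Let_def mn by blast
    show "Y \<in> psd_cone (dim_col A + 1)" using Yp mn by simp
    have Ys: "Y \<in> sym_mats (n + 1)" using Yp by (simp add: psd_cone_def)
    hence Yc: "Y \<in> carrier_mat (n + 1) (n + 1)" by (simp add: sym_mats_def)
    have "append_cols (0\<^sub>m m 1) A * Y = 0\<^sub>m m (n + 1)"
    proof (rule eq_matI)
      fix i j assume "i < dim_row (0\<^sub>m m (n + 1))" "j < dim_col (0\<^sub>m m (n + 1))"
      hence i: "i < m" and j: "j < n + 1" by auto
      have "(\<Sum>k<n. A $$ (i, k) * Y $$ (Suc k, j)) = 0"
      proof (cases j)
        case 0
        have "(\<Sum>k<n. A $$ (i, k) * Y $$ (Suc k, j)) = (A *\<^sub>v x) $ i"
          using A x X i by (auto simp: Y 0 scalar_prod_def mat_of_row_def lessThan_atLeast0)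
        then show ?thesis using Ax i by simp
      next
        case (Suc l)
        have "(\<Sum>k<n. A $$ (i, k) * Y $$ (Suc k, j)) = (A * X) $$ (i, l)"
          using A x X i j by (auto simp: Y Suc scalar_prod_def mat_of_row_def lessThan_atLeast0)
        then show ?thesis using AX i j Suc by simp
      qed
      then show "(append_cols (0\<^sub>m m 1) A * Y) $$ (i, j) = 0\<^sub>m m (n + 1) $$ (i, j)"
        using append_cols_zero_mult[OF A Yc i j] i j by simp
    qed (use A Yc in \<open>auto simp: append_cols_def\<close>)
    moreover have "Y $$ (i, i) = Y $$ (0, i)" if "i \<in> {1..n}" for i
      using that d x X by (auto simp: Y mat_of_row_def)
    moreover have "Y $$ (0, 0) = 1" using X by (simp add: Y)
    ultimately show "Y \<in> relaxation_affine A"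
      using Ys unfolding relaxation_affine_def Let_def mn by blast
  next
    fix Y assume "Y \<in> relaxation_affine A \<inter> psd_cone (dim_col A + 1)"
    hence Yp: "Y \<in> psd_cone (n + 1)" and Ys: "Y \<in> sym_mats (n + 1)"
      and Y0: "Y $$ (0, 0) = 1" and d: "\<forall>i \<in> {1..n}. Y $$ (i, i) = Y $$ (0, i)"
      and AY: "append_cols (0\<^sub>m m 1) A * Y = 0\<^sub>m m (n + 1)"
      unfolding relaxation_affine_def Let_def mn by auto
    have Yc: "Y \<in> carrier_mat (n + 1) (n + 1)" and T: "transpose_mat Y = Y"
      using Ys by (auto simp: sym_mats_def)
    have sy: "Y $$ (i, j) = Y $$ (j, i)" if "i < n + 1" "j < n + 1" for i j
      using arg_cong[OF T, of "\<lambda>M. M $$ (i, j)"] that Yc by simp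
    define x where "x = vec n (\<lambda>i. Y $$ (0, Suc i))"
    define X where "X = mat n n (\<lambda>(i, j). Y $$ (Suc i, Suc j))"
    have x: "x \<in> carrier_vec n" and X: "X \<in> carrier_mat n n" by (auto simp: x_def X_def)
    have s: "(\<Sum>k<n. A $$ (i, k) * Y $$ (Suc k, j)) = 0" if "i < m" "j < n + 1" for i j
      using append_cols_zero_mult[OF A Yc that] AY that by simp
    have "Y = four_block_mat (1\<^sub>m 1) (mat_of_row x) (transpose_mat (mat_of_row x)) X"
      by (rule eq_matI) (use Yc x X Y0 sy in \<open>auto simp: mat_of_row_def x_def X_def\<close>)
    moreover have "\<forall>i < n. X $$ (i, i) = x $ i" using d by (auto simp: x_def X_def)
    moreover have "A *\<^sub>v x = 0\<^sub>v m"
    proof (rule eq_vecI)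
      fix i assume "i < dim_vec (0\<^sub>v m :: real vec)"
      then show "(A *\<^sub>v x) $ i = 0\<^sub>v m $ i"
        using s[of i 0] A x sy
        by (auto simp: scalar_prod_def x_def lessThan_atLeast0)
    qed (use A in auto)
    moreover have "A * X = 0\<^sub>m m n"
    proof (rule eq_matI)
      fix i j assume "i < dim_row (0\<^sub>m m n :: real mat)" "j < dim_col (0\<^sub>m m n :: real mat)"
      then show "(A * X) $$ (i, j) = 0\<^sub>m m n $$ (i, j)"
        using s[of i "Suc j"] A X
        by (auto simp: scalar_prod_def X_def lessThan_atLeast0)
    qed (use A X in auto)
    ultimately show "Y \<in> relaxation A"
      using Yp x X unfolding relaxation_def Let_def mn by blast
  qed
qed

end

(* Let v_0 = e_0 and v_a = (0, 1^a, ..., n^a).  A matrix Y with (0 A) Y = 0 has the form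
   sum_{a,b <= r} R_ab v_a v_b^T, and Y_kk - Y_0k is then a polynomial in k of degree at most 2r
   that vanishes at 0 and at 1, ..., n, hence identically.  So the affine constraints say exactly
   that the antidiagonal sums of (R_ab)_{a,b >= 1} of index t equal R_0t for t <= r and 0 for t > r.
   Lower bound: a matrix W in the annihilator has a reduced form G_ab = v_a^T W v_b that is of
   Hankel type up to its border, and nonnegativity on span(v_0, ..., v_q) forces
   all entries with indices below q to vanish.  Every step thus removes at most one dimension,
   and v_1 v_1^T is not removed before step r.
   Upper bound: with dual vectors w_a, the antidiagonal sums of index 2r, 2r - 2, ..., 2 are
   exposing certificates that remove v_r, v_{r-1}, ..., v_1 in turn. *)
theory Submission
  imports Defs "HOL-Computational_Algebra.Polynomial" "Jordan_Normal_Form.Determinant"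
begin

section \<open>Bilinear forms of matrices\<close>

text \<open>Vectors are functions on \<open>nat\<close>, so linear combinations carry no dimension
  side conditions; only the entries below \<open>p\<close> count.\<close>

definition bform :: "nat \<Rightarrow> real mat \<Rightarrow> (nat \<Rightarrow> real) \<Rightarrow> (nat \<Rightarrow> real) \<Rightarrow> real" where
  "bform p Y x y = (\<Sum>i<p. \<Sum>j<p. x i * Y $$ (i, j) * y j)"

lemma bform_add_left: "bform p Y (\<lambda>i. x i + y i) z = bform p Y x z + bform p Y y z"
  by (simp add: bform_def algebra_simps sum.distrib)

lemma bform_add_right: "bform p Y z (\<lambda>i. x i + y i) = bform p Y z x + bform p Y z y"
  by (simp add: bform_def algebra_simps sum.distrib)

lemma bform_scale_left: "bform p Y (\<lambda>i. c * x i) z = c * bform p Y x z"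
  by (simp add: bform_def sum_distrib_left mult.assoc)

lemma bform_scale_right: "bform p Y z (\<lambda>i. c * x i) = c * bform p Y z x"
  by (simp add: bform_def sum_distrib_left algebra_simps)

lemma bform_sum_left:
  "bform p Y (\<lambda>i. \<Sum>a\<in>S. c a * f a i) z = (\<Sum>a\<in>S. c a * bform p Y (f a) z)"
proof -
  have "bform p Y (\<lambda>i. \<Sum>a\<in>S. c a * f a i) z
      = (\<Sum>i<p. \<Sum>j<p. \<Sum>a\<in>S. c a * (f a i * Y $$ (i, j) * z j))"
    by (simp add: bform_def sum_distrib_right mult.assoc)
  also have "\<dots> = (\<Sum>i<p. \<Sum>a\<in>S. \<Sum>j<p. c a * (f a i * Y $$ (i, j) * z j))"
    by (intro sum.cong refl sum.swap)
  also have "\<dots> = (\<Sum>a\<in>S. \<Sum>i<p. \<Sum>j<p. c a * (f a i * Y $$ (i, j) * z j))"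
    by (rule sum.swap)
  finally show ?thesis by (simp add: bform_def sum_distrib_left)
qed

lemma sym_mats_index:
  assumes "Y \<in> sym_mats p" "i < p" "j < p"
  shows "Y $$ (i, j) = Y $$ (j, i)"
  using assms index_transpose_mat(1)[of i Y j] by (auto simp: sym_mats_def)

lemma bform_commute:
  assumes "Y \<in> sym_mats p"
  shows "bform p Y x y = bform p Y y x"
proof -
  have "bform p Y x y = (\<Sum>j<p. \<Sum>i<p. x i * Y $$ (i, j) * y j)"
    unfolding bform_def by (rule sum.swap)
  also have "\<dots> = bform p Y y x"
    unfolding bform_def by (intro sum.cong refl) (simp add: sym_mats_index[OF assms])
  finally show ?thesis .
qed

lemma bform_sum_right:
  assumes "Y \<in> sym_mats p"
  shows "bform p Y z (\<lambda>i. \<Sum>a\<in>S. c a * f a i) = (\<Sum>a\<in>S. c a * bform p Y z (f a))"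
  using assms by (simp add: bform_commute[of Y p z] bform_sum_left)

lemma bform_lincomb:
  assumes "X \<in> carrier_mat p p" "Y \<in> carrier_mat p p"
  shows "bform p (s \<cdot>\<^sub>m X + t \<cdot>\<^sub>m Y) x y = s * bform p X x y + t * bform p Y x y"
proof -
  have "bform p (s \<cdot>\<^sub>m X + t \<cdot>\<^sub>m Y) x y
      = (\<Sum>i<p. \<Sum>j<p. s * (x i * X $$ (i, j) * y j) + t * (x i * Y $$ (i, j) * y j))"
    unfolding bform_def by (intro sum.cong refl) (use assms in \<open>simp add: algebra_simps\<close>)
  then show ?thesis by (simp add: bform_def sum.distrib sum_distrib_left)
qed

lemma psd_cone_iff:
  "Y \<in> psd_cone p \<longleftrightarrow> Y \<in> sym_mats p \<and> (\<forall>x. 0 \<le> bform p Y x x)"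
proof -
  have eq: "v \<bullet> (Y *\<^sub>v v) = bform p Y (\<lambda>i. v $ i) (\<lambda>i. v $ i)"
    if "Y \<in> sym_mats p" "v \<in> carrier_vec p" for v
    using that
    by (auto simp: sym_mats_def bform_def scalar_prod_def lessThan_atLeast0 sum_distrib_left
        mult.assoc intro!: sum.cong)
  have "0 \<le> bform p Y x x"
    if "Y \<in> sym_mats p" "\<forall>v\<in>carrier_vec p. 0 \<le> v \<bullet> (Y *\<^sub>v v)" for x
  proof -
    have "bform p Y x x = bform p Y (\<lambda>i. vec p x $ i) (\<lambda>i. vec p x $ i)"
      by (simp add: bform_def)
    also have "\<dots> = vec p x \<bullet> (Y *\<^sub>v vec p x)" using that(1) by (simp add: eq)
    also have "\<dots> \<ge> 0" using that(2) by simp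
    finally show ?thesis .
  qed
  then show ?thesis by (auto simp: psd_cone_def eq)
qed

lemma psd_cone_sym: "Y \<in> psd_cone p \<Longrightarrow> Y \<in> sym_mats p"
  by (simp add: psd_cone_def)

lemma sym_mats_carrier: "Y \<in> sym_mats p \<Longrightarrow> Y \<in> carrier_mat p p"
  by (simp add: sym_mats_def)

text \<open>An affine function of \<open>t\<close> with nonzero slope takes the value -1
  somewhere.\<close>

lemma linear_nonneg_imp_zero:
  fixes b c :: real
  assumes "\<And>t. 0 \<le> c + 2 * t * b"
  shows "b = 0"
proof (rule ccontr)
  assume "b \<noteq> 0"
  then have "c + 2 * (- (c + 1) / (2 * b)) * b = - 1"
    by (simp add: field_simps)
  with assms[of "- (c + 1) / (2 * b)"] show False by linarith
qed

text \<open>Expanding at \<open>y + t * x\<close> leaves an affine function of \<open>t\<close> with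
  slope \<open>2 * bform p W x y\<close>. Nonnegativity is asked on this line only, because the
  annihilators of the lower bound are nonnegative merely on a subspace.\<close>

lemma bform_isotropic:
  assumes W: "W \<in> sym_mats p" and x: "bform p W x x = 0"
    and nonneg: "\<And>t. 0 \<le> bform p W (\<lambda>i. y i + t * x i) (\<lambda>i. y i + t * x i)"
  shows "bform p W x y = 0"
proof (rule linear_nonneg_imp_zero)
  fix t
  show "0 \<le> bform p W y y + 2 * t * bform p W x y"
    using nonneg[of t] x bform_commute[OF W, of y x]
    by (simp add: bform_add_left bform_add_right bform_scale_left bform_scale_right)
qed

lemma psd_isotropic:
  assumes "Y \<in> psd_cone p" "bform p Y x x = 0"
  shows "bform p Y x y = 0" "bform p Y y x = 0"
proof -
  show "bform p Y x y = 0"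
    using assms by (subst bform_isotropic) (auto simp: psd_cone_iff)
  then show "bform p Y y x = 0"
    using assms(1) by (simp add: bform_commute[OF psd_cone_sym])
qed

text \<open>Pairing with a unit vector reads off one entry of the row vector x^T Y; in this way
  isotropy of \<open>x\<close> becomes a system of linear equations for \<open>Y\<close>.\<close>

lemma bform_unit_right:
  assumes "j < p"
  shows "bform p Y x (\<lambda>k. of_bool (k = j)) = (\<Sum>i<p. x i * Y $$ (i, j))"
proof -
  have "bform p Y x (\<lambda>k. of_bool (k = j)) = (\<Sum>i<p. \<Sum>l<p. if l = j then x i * Y $$ (i, j) else 0)"
    unfolding bform_def by (intro sum.cong refl) auto
  then show ?thesis using assms by simp
qed

section \<open>Trace inner products with dyads and rank-one matrices\<close>

lemma mat_inner_sum:
  assumes "Z \<in> carrier_mat p p" "Y \<in> carrier_mat p p"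
  shows "mat_inner Z Y = (\<Sum>i<p. \<Sum>j<p. Z $$ (i, j) * Y $$ (j, i))"
  using assms unfolding mat_inner_def mat_trace_def
  by (auto simp: scalar_prod_def lessThan_atLeast0 intro!: sum.cong)

lemma mat_inner_commute:
  assumes "Z \<in> carrier_mat p p" "Y \<in> carrier_mat p p"
  shows "mat_inner Z Y = mat_inner Y Z"
proof -
  have "mat_inner Z Y = (\<Sum>j<p. \<Sum>i<p. Z $$ (i, j) * Y $$ (j, i))"
    unfolding mat_inner_sum[OF assms] by (rule sum.swap)
  then show ?thesis by (simp add: mat_inner_sum[OF assms(2,1)] mult.commute)
qed

definition fmat :: "nat \<Rightarrow> (nat \<Rightarrow> nat \<Rightarrow> real) \<Rightarrow> real mat" where
  "fmat p f = mat p p (\<lambda>(i, j). f i j)"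

lemma fmat_carrier [simp]: "fmat p f \<in> carrier_mat p p"
  by (simp add: fmat_def)

lemma fmat_index [simp]: "i < p \<Longrightarrow> j < p \<Longrightarrow> fmat p f $$ (i, j) = f i j"
  by (simp add: fmat_def)

lemma fmat_sym:
  assumes "\<And>i j. i < p \<Longrightarrow> j < p \<Longrightarrow> f i j = f j i"
  shows "fmat p f \<in> sym_mats p"
  unfolding sym_mats_def fmat_def using assms by (auto intro!: eq_matI)

definition rank_one :: "nat \<Rightarrow> (nat \<Rightarrow> real) \<Rightarrow> real mat" where
  "rank_one p u = fmat p (\<lambda>i j. u i * u j)"

lemma bform_rank_one: "bform p (rank_one p u) x x = (\<Sum>i<p. x i * u i)\<^sup>2"
  by (simp add: bform_def rank_one_def power2_eq_square sum_product algebra_simps)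

lemma rank_one_psd: "rank_one p u \<in> psd_cone p"
  unfolding psd_cone_iff bform_rank_one by (auto simp: rank_one_def intro: fmat_sym)

lemma mat_inner_fmat:
  assumes "Y \<in> carrier_mat p p"
  shows "mat_inner (fmat p f) Y = (\<Sum>i<p. \<Sum>j<p. f i j * Y $$ (j, i))"
  using assms by (simp add: mat_inner_sum[of _ p])

lemma mat_inner_fmat_add:
  assumes "Y \<in> carrier_mat p p"
  shows "mat_inner (fmat p (\<lambda>i j. f i j + g i j)) Y
    = mat_inner (fmat p f) Y + mat_inner (fmat p g) Y"
  by (simp add: mat_inner_fmat[OF assms] distrib_right sum.distrib)

lemma mat_inner_fmat_dyads:
  assumes Y: "Y \<in> carrier_mat p p"
  shows "mat_inner (fmat p (\<lambda>i j. \<Sum>s\<in>S. g s * x s i * y s j)) Y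
    = (\<Sum>s\<in>S. g s * bform p Y (y s) (x s))"
proof -
  have "mat_inner (fmat p (\<lambda>i j. \<Sum>s\<in>S. g s * x s i * y s j)) Y
      = (\<Sum>j<p. \<Sum>i<p. \<Sum>s\<in>S. g s * (y s j * Y $$ (j, i) * x s i))"
    unfolding mat_inner_fmat[OF Y]
    by (subst sum.swap) (simp add: sum_distrib_right sum_distrib_left mult_ac)
  also have "\<dots> = (\<Sum>j<p. \<Sum>s\<in>S. \<Sum>i<p. g s * (y s j * Y $$ (j, i) * x s i))"
    by (intro sum.cong refl sum.swap)
  also have "\<dots> = (\<Sum>s\<in>S. \<Sum>j<p. \<Sum>i<p. g s * (y s j * Y $$ (j, i) * x s i))"
    by (rule sum.swap)
  finally show ?thesis by (simp add: bform_def sum_distrib_left)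
qed

lemma mat_inner_fmat_dyad:
  assumes "Y \<in> carrier_mat p p"
  shows "mat_inner (fmat p (\<lambda>i j. c * x i * y j)) Y = c * bform p Y y x"
  using mat_inner_fmat_dyads[OF assms, where S = "{()}" and g = "\<lambda>_. c"
      and x = "\<lambda>_. x" and y = "\<lambda>_. y"] by simp

text \<open>Through this identity, membership of \<open>W\<close> in the dual cone of a face becomes
  nonnegativity of a quadratic form on the vectors whose squares lie in the face.\<close>

lemma mat_inner_rank_one:
  assumes "W \<in> carrier_mat p p"
  shows "mat_inner W (rank_one p u) = bform p W u u"
  using mat_inner_fmat_dyad[OF assms, of 1 u u] mat_inner_commute[OF assms, of "rank_one p u"]
  by (simp add: rank_one_def)


section \<open>Faces of the positive semidefinite cone\<close>

lemma psd_cone_convex: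
  assumes X: "X \<in> psd_cone p" and Y: "Y \<in> psd_cone p" and t: "0 \<le> t" "t \<le> 1"
  shows "(1 - t) \<cdot>\<^sub>m X + t \<cdot>\<^sub>m Y \<in> psd_cone p"
proof -
  have c: "X \<in> carrier_mat p p" "Y \<in> carrier_mat p p"
    using X Y psd_cone_sym sym_mats_carrier by blast+
  have "transpose_mat ((1 - t) \<cdot>\<^sub>m X + t \<cdot>\<^sub>m Y) = (1 - t) \<cdot>\<^sub>m X + t \<cdot>\<^sub>m Y"
  proof (rule eq_matI)
    fix i j
    assume "i < dim_row ((1 - t) \<cdot>\<^sub>m X + t \<cdot>\<^sub>m Y)" "j < dim_col ((1 - t) \<cdot>\<^sub>m X + t \<cdot>\<^sub>m Y)"
    then have ij: "i < p" "j < p" using c by auto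
    have "X $$ (j, i) = X $$ (i, j)" "Y $$ (j, i) = Y $$ (i, j)"
      using X Y ij by (auto intro: sym_mats_index simp: psd_cone_def)
    then show "transpose_mat ((1 - t) \<cdot>\<^sub>m X + t \<cdot>\<^sub>m Y) $$ (i, j) = ((1 - t) \<cdot>\<^sub>m X + t \<cdot>\<^sub>m Y) $$ (i, j)"
      using c ij by simp
  qed (use c in auto)
  then have "(1 - t) \<cdot>\<^sub>m X + t \<cdot>\<^sub>m Y \<in> sym_mats p"
    using c by (simp add: sym_mats_def)
  then show ?thesis using X Y t by (simp add: psd_cone_iff bform_lincomb[OF c])
qed

text \<open>A convex combination with positive weights of two nonnegative numbers vanishes only if
  both do. All faces of the upper bound have this shape.\<close>

lemma isotropic_face:
  "mat_face_of {Y \<in> psd_cone p. \<forall>x\<in>S. bform p Y x x = 0} (psd_cone p)"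
  unfolding mat_face_of_def mat_convex_def
proof (intro conjI ballI allI impI)
  fix X Y :: "real mat" and t :: real
  assume "X \<in> {Y \<in> psd_cone p. \<forall>x\<in>S. bform p Y x x = 0}"
    "Y \<in> {Y \<in> psd_cone p. \<forall>x\<in>S. bform p Y x x = 0}" "0 \<le> t \<and> t \<le> 1"
  then show "(1 - t) \<cdot>\<^sub>m X + t \<cdot>\<^sub>m Y \<in> {Y \<in> psd_cone p. \<forall>x\<in>S. bform p Y x x = 0}"
    by (simp add: psd_cone_convex bform_lincomb psd_cone_sym sym_mats_carrier)
next
  fix X Y :: "real mat" and t :: real
  assume X: "X \<in> psd_cone p" and Y: "Y \<in> psd_cone p"
    and "0 < t \<and> t < 1 \<and> (1 - t) \<cdot>\<^sub>m X + t \<cdot>\<^sub>m Y \<in> {Y \<in> psd_cone p. \<forall>x\<in>S. bform p Y x x = 0}"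
  then have t: "0 < t" "t < 1"
    and e: "\<forall>x\<in>S. (1 - t) * bform p X x x + t * bform p Y x x = 0"
    by (auto simp: bform_lincomb psd_cone_sym sym_mats_carrier)
  have "bform p X x x = 0 \<and> bform p Y x x = 0" if "x \<in> S" for x
  proof -
    have "0 \<le> bform p X x x" "0 \<le> bform p Y x x" using X Y by (auto simp: psd_cone_iff)
    then have "0 \<le> (1 - t) * bform p X x x" "0 \<le> t * bform p Y x x" using t by auto
    then have "(1 - t) * bform p X x x = 0 \<and> t * bform p Y x x = 0"
      using bspec[OF e that] by linarith
    then show ?thesis using t by simp
  qed
  then show "X \<in> {Y \<in> psd_cone p. \<forall>x\<in>S. bform p Y x x = 0}"
    "Y \<in> {Y \<in> psd_cone p. \<forall>x\<in>S. bform p Y x x = 0}"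
    using X Y by auto
qed auto

section \<open>Faces are closed under nonnegative scaling\<close>

lemma zero_psd: "0\<^sub>m p p \<in> psd_cone p"
  by (auto simp: psd_cone_iff sym_mats_def bform_def)

lemma smult_psd:
  assumes "X \<in> psd_cone p" "0 \<le> c"
  shows "c \<cdot>\<^sub>m X \<in> psd_cone p"
proof -
  have X: "X \<in> carrier_mat p p" using assms psd_cone_sym sym_mats_carrier by blast
  have "transpose_mat (c \<cdot>\<^sub>m X) = c \<cdot>\<^sub>m transpose_mat X"
    by (rule eq_matI) auto
  then have "c \<cdot>\<^sub>m X \<in> sym_mats p"
    using assms(1) X by (auto simp: psd_cone_def sym_mats_def)
  moreover have "bform p (c \<cdot>\<^sub>m X) x x = c * bform p X x x" for x
    using X by (simp add: bform_def sum_distrib_left algebra_simps)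
  ultimately show ?thesis using assms by (simp add: psd_cone_iff)
qed

text \<open>For \<open>u > 1\<close> the point \<open>X\<close> lies strictly between the zero
  matrix and \<open>u\<close> times \<open>X\<close>, so the face property yields both ends; smaller
  multiples follow by convexity.\<close>

lemma face_contains_ray:
  assumes F: "mat_face_of F (psd_cone p)" and X: "X \<in> F" and c: "0 \<le> c"
  shows "c \<cdot>\<^sub>m X \<in> F"
proof -
  have Xp: "X \<in> psd_cone p" using F X by (auto simp: mat_face_of_def)
  then have Xc: "X \<in> carrier_mat p p" using psd_cone_sym sym_mats_carrier by blast
  have big: "u \<cdot>\<^sub>m X \<in> F \<and> 0\<^sub>m p p \<in> F" if u: "u > 1" for u
  proof -
    have "(1 - 1 / u) \<cdot>\<^sub>m 0\<^sub>m p p + (1 / u) \<cdot>\<^sub>m (u \<cdot>\<^sub>m X) = X"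
      by (rule eq_matI) (use u Xc in auto)
    moreover have "0 < 1 / u \<and> 1 / u < 1" using u by simp
    moreover have "u \<cdot>\<^sub>m X \<in> psd_cone p" using smult_psd[OF Xp] u by simp
    ultimately show ?thesis
      using F X zero_psd unfolding mat_face_of_def by metis
  qed
  show ?thesis
  proof (cases "c > 1")
    case False
    \<comment> \<open>The instance \<open>big[of 2]\<close> only serves to place the zero matrix in
      \<open>F\<close>.\<close>
    have "(1 - c) \<cdot>\<^sub>m 0\<^sub>m p p + c \<cdot>\<^sub>m X = c \<cdot>\<^sub>m X"
      by (rule eq_matI) (use Xc in auto)
    moreover have "(1 - c) \<cdot>\<^sub>m 0\<^sub>m p p + c \<cdot>\<^sub>m X \<in> F"
      using F X c False big[of 2] unfolding mat_face_of_def mat_convex_def by auto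
    ultimately show ?thesis by simp
  qed (use big in auto)
qed



section \<open>Facial reduction with power vectors\<close>

text \<open>Index 0 stands for the unit vector e_0, not for the all-ones vector that
  \<open>real k ^ 0\<close> would give.\<close>

definition power_vec :: "nat \<Rightarrow> nat \<Rightarrow> real" where
  "power_vec a k = (if a = 0 then of_bool (k = 0) else real k ^ a)"

lemma power_vec_at_0 [simp]: "power_vec a 0 = of_bool (a = 0)"
  by (simp add: power_vec_def)

lemma power_vec_0 [simp]: "k \<noteq> 0 \<Longrightarrow> power_vec 0 k = 0"
  by (simp add: power_vec_def)

lemma power_vec_pos: "a \<noteq> 0 \<Longrightarrow> power_vec a k = real k ^ a"
  by (simp add: power_vec_def)

lemma poly_zero_if_many_roots:
  fixes P :: "real poly"
  assumes "degree P \<le> N" "\<And>k. k \<le> N \<Longrightarrow> poly P (real k) = 0"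
  shows "P = 0"
proof (rule ccontr)
  assume P: "P \<noteq> 0"
  have "card (real ` {..N}) \<le> card {x. poly P x = 0}"
    using assms(2) poly_roots_finite[OF P] by (intro card_mono) auto
  also have "\<dots> \<le> degree P" using P by (rule card_poly_roots_bound)
  finally show False using assms(1) by (simp add: card_image)
qed

text \<open>The rows of (0 A) are the \<open>\<alpha> l\<close>. The last three assumptions say that
  the power vectors of index at most \<open>r\<close> form a basis of the kernel of these rows, with
  the \<open>w a\<close> giving the coordinates. The bound \<open>2 * r \<le> n\<close> provides
  enough diagonal conditions to determine a polynomial of degree at most
  \<open>2 * r\<close>.\<close>

locale power_kernel =
  fixes n m r p :: nat and \<alpha> w :: "nat \<Rightarrow> nat \<Rightarrow> real"
  assumes size: "2 * r \<le> n" and r_pos: "0 < r" and p_eq: "p = Suc n"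
    and kernel: "\<And>l a. l < m \<Longrightarrow> a \<le> r \<Longrightarrow> (\<Sum>k<p. \<alpha> l k * power_vec a k) = 0"
    and dual: "\<And>a b. a \<le> r \<Longrightarrow> b \<le> r \<Longrightarrow> (\<Sum>k<p. w a k * power_vec b k) = of_bool (a = b)"
    and expand: "\<And>x k. (\<And>l. l < m \<Longrightarrow> (\<Sum>k<p. \<alpha> l k * x k) = 0) \<Longrightarrow> k < p \<Longrightarrow>
        x k = (\<Sum>a\<le>r. power_vec a k * (\<Sum>i<p. w a i * x i))"
begin

definition L :: "real mat set" where
  "L = {Y \<in> sym_mats p. Y $$ (0, 0) = 1 \<and> (\<forall>i\<in>{1..n}. Y $$ (i, i) = Y $$ (0, i)) \<and>
        (\<forall>l<m. \<forall>j<p. (\<Sum>k<p. \<alpha> l k * Y $$ (k, j)) = 0)}"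

lemma p_pos: "0 < p"
  by (simp add: p_eq)

lemma L_sym: "Y \<in> L \<Longrightarrow> Y \<in> sym_mats p"
  by (simp add: L_def)

text \<open>The columns of \<open>Y\<close> lie in the kernel, hence expand in power vectors; by
  symmetry the rows do too. The coefficients are the matrix R of the overview.\<close>

lemma matrix_expand:
  assumes Y: "Y \<in> sym_mats p"
    and ker: "\<And>l j. l < m \<Longrightarrow> j < p \<Longrightarrow> (\<Sum>k<p. \<alpha> l k * Y $$ (k, j)) = 0"
    and ij: "i < p" "j < p"
  shows "Y $$ (i, j) = (\<Sum>a\<le>r. \<Sum>b\<le>r. power_vec a i * power_vec b j * bform p Y (w a) (w b))"
proof -
  have col: "Y $$ (i, j) = (\<Sum>a\<le>r. power_vec a i * (\<Sum>k<p. w a k * Y $$ (k, j)))"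
    if "i < p" "j < p" for i j
    using expand[of "\<lambda>k. Y $$ (k, j)" i] ker that by blast
  have "(\<Sum>k<p. w a k * Y $$ (k, j)) = (\<Sum>b\<le>r. power_vec b j * bform p Y (w a) (w b))" for a
  proof -
    \<comment> \<open>Symmetry turns the entry at \<open>(k, j)\<close> into the one at
      \<open>(j, k)\<close>, to which the expansion of column \<open>k\<close> applies.\<close>
    have "(\<Sum>k<p. w a k * Y $$ (k, j))
        = (\<Sum>k<p. w a k * (\<Sum>b\<le>r. power_vec b j * (\<Sum>l<p. w b l * Y $$ (l, k))))"
      using ij by (intro sum.cong refl) (simp add: col[symmetric] sym_mats_index[OF Y, of _ j])
    also have "\<dots> = (\<Sum>k<p. \<Sum>b\<le>r. power_vec b j * (\<Sum>l<p. w a k * Y $$ (k, l) * w b l))"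
      unfolding sum_distrib_left
      by (intro sum.cong refl) (use sym_mats_index[OF Y] in \<open>simp add: mult_ac\<close>)
    also have "\<dots> = (\<Sum>b\<le>r. \<Sum>k<p. power_vec b j * (\<Sum>l<p. w a k * Y $$ (k, l) * w b l))"
      by (rule sum.swap)
    finally show ?thesis by (simp add: bform_def sum_distrib_left)
  qed
  then show ?thesis using col[OF ij] by (simp add: sum_distrib_left mult.assoc)
qed

subsection \<open>The lower bound\<close>

abbreviation G :: "real mat \<Rightarrow> nat \<Rightarrow> nat \<Rightarrow> real" where
  "G W a b \<equiv> bform p W (power_vec a) (power_vec b)"

text \<open>A family of points of \<open>L\<close> for testing annihilators: two symmetrized dyads
  added to e_0 e_0^T, which supplies the corner entry 1. Both kinds of relations between the entries
  of \<open>G\<close> come from it.\<close>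

definition two_dyads :: "real \<Rightarrow> nat \<Rightarrow> nat \<Rightarrow> real \<Rightarrow> nat \<Rightarrow> nat \<Rightarrow> real mat" where
  "two_dyads c a b d e f = fmat p (\<lambda>i j. power_vec 0 i * power_vec 0 j
      + (c * power_vec a i * power_vec b j + (c * power_vec b i * power_vec a j
      + (d * power_vec e i * power_vec f j + d * power_vec f i * power_vec e j))))"

lemma mat_inner_two_dyads:
  assumes W: "W \<in> sym_mats p"
  shows "mat_inner W (two_dyads c a b d e f) = G W 0 0 + 2 * c * G W a b + 2 * d * G W e f"
proof -
  have Wc: "W \<in> carrier_mat p p" using W by (rule sym_mats_carrier)
  have "mat_inner W (two_dyads c a b d e f) = mat_inner (two_dyads c a b d e f) W"
    by (rule mat_inner_commute[OF Wc]) (simp add: two_dyads_def)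
  also have "\<dots> = G W 0 0 + (c * G W b a + (c * G W a b + (d * G W f e + d * G W e f)))"
    unfolding two_dyads_def
    using mat_inner_fmat_dyad[OF Wc, of 1 "power_vec 0" "power_vec 0"]
    by (simp only: mat_inner_fmat_add[OF Wc] mat_inner_fmat_dyad[OF Wc] mult_1)
  finally show ?thesis by (simp add: bform_commute[OF W, of "power_vec b"] bform_commute[OF W, of "power_vec f"])
qed

text \<open>The assumption \<open>diag\<close> is the condition that diagonal and border agree at
  \<open>k\<close>. Only \<open>e\<close> may be 0; its dyad then contributes to the border and not
  to the diagonal.\<close>

lemma two_dyads_in_L:
  assumes le: "a \<le> r" "b \<le> r" "e \<le> r" "f \<le> r" and pos: "0 < a" "0 < b" "0 < f"
    and diag: "\<And>k. 0 < k \<Longrightarrow> 2 * c * real k ^ (a + b) + 2 * d * power_vec e k * real k ^ f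
      = (if e = 0 then d * real k ^ f else 0)"
  shows "two_dyads c a b d e f \<in> L"
  unfolding L_def
proof (intro CollectI conjI allI ballI impI)
  show "two_dyads c a b d e f \<in> sym_mats p"
    unfolding two_dyads_def by (rule fmat_sym) (simp add: algebra_simps)
  show "two_dyads c a b d e f $$ (0, 0) = 1"
    using pos p_pos by (auto simp: two_dyads_def)
  fix i assume "i \<in> {1..n}"
  then have "0 < i" "i < p" by (auto simp: p_eq)
  then show "two_dyads c a b d e f $$ (i, i) = two_dyads c a b d e f $$ (0, i)"
    using pos diag[of i] p_pos by (auto simp: two_dyads_def power_vec_pos zero_power power_add algebra_simps)
next
  fix l j assume l: "l < m" and j: "j < p"
  have z: "(\<Sum>k<p. \<alpha> l k * (x * power_vec g k)) = 0" if "g \<le> r" for x g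
    using kernel[OF l that] by (simp add: mult.left_commute[of _ x] sum_distrib_left[symmetric])
  have "(\<Sum>k<p. \<alpha> l k * two_dyads c a b d e f $$ (k, j))
      = (\<Sum>k<p. \<alpha> l k * (power_vec 0 j * power_vec 0 k)
        + (\<alpha> l k * (c * power_vec b j * power_vec a k) + (\<alpha> l k * (c * power_vec a j * power_vec b k)
        + (\<alpha> l k * (d * power_vec f j * power_vec e k) + \<alpha> l k * (d * power_vec e j * power_vec f k)))))"
  proof (rule sum.cong)
    fix k assume "k \<in> {..<p}"
    then have "two_dyads c a b d e f $$ (k, j) = power_vec 0 j * power_vec 0 k
        + (c * power_vec b j * power_vec a k + (c * power_vec a j * power_vec b k
        + (d * power_vec f j * power_vec e k + d * power_vec e j * power_vec f k)))"
      using j unfolding two_dyads_def by (simp add: mult.commute mult.left_commute)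
    then show "\<alpha> l k * two_dyads c a b d e f $$ (k, j) = \<alpha> l k * (power_vec 0 j * power_vec 0 k)
        + (\<alpha> l k * (c * power_vec b j * power_vec a k) + (\<alpha> l k * (c * power_vec a j * power_vec b k)
        + (\<alpha> l k * (d * power_vec f j * power_vec e k) + \<alpha> l k * (d * power_vec e j * power_vec f k))))"
      by (simp only: distrib_left)
  qed simp
  also have "\<dots> = 0"
    using le by (simp only: sum.distrib z le0 add_0_right)
  finally show "(\<Sum>k<p. \<alpha> l k * two_dyads c a b d e f $$ (k, j)) = 0" .
qed

text \<open>This point is also positive semidefinite. It forces the corner of \<open>G\<close> to
  vanish, and it will turn out to span the minimal face.\<close>

lemma rank_one_e0_in_L: "rank_one p (power_vec 0) \<in> L"
  unfolding L_def
proof (intro CollectI conjI allI ballI impI)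
  show "rank_one p (power_vec 0) \<in> sym_mats p" using rank_one_psd psd_cone_sym by blast
  fix l j assume l: "l < m" and j: "j < p"
  have "(\<Sum>k<p. \<alpha> l k * rank_one p (power_vec 0) $$ (k, j))
      = power_vec 0 j * (\<Sum>k<p. \<alpha> l k * power_vec 0 k)"
    unfolding sum_distrib_left
    using j by (intro sum.cong refl) (simp add: rank_one_def)
  then show "(\<Sum>k<p. \<alpha> l k * rank_one p (power_vec 0) $$ (k, j)) = 0"
    using kernel[OF l, of 0] by simp
qed (auto simp: rank_one_def p_eq)

section \<open>Linear relations for annihilators of \<open>L\<close>\<close>

context
  fixes W assumes W: "W \<in> orth p L"
begin

lemma orth_L_sym: "W \<in> sym_mats p"
  using W by (simp add: orth_def)

lemma orth_L_two_dyads: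
  assumes "two_dyads c a b d e f \<in> L"
  shows "G W 0 0 + 2 * c * G W a b + 2 * d * G W e f = 0"
  using W assms mat_inner_two_dyads[OF orth_L_sym, of c a b d e f] by (simp add: orth_def)

lemma orth_L_00: "G W 0 0 = 0"
  using W rank_one_e0_in_L mat_inner_rank_one[OF sym_mats_carrier[OF orth_L_sym], symmetric]
  by (simp add: orth_def)

text \<open>The two dyads have the same diagonal \<open>real k ^ (a + b)\<close> and no border, so
  their difference can be added without leaving \<open>L\<close>.\<close>

lemma orth_L_hankel:
  assumes "a \<le> r" "b \<le> r" "e \<le> r" "f \<le> r" "0 < a" "0 < b" "0 < e" "0 < f" "a + b = e + f"
  shows "G W a b = G W e f"
proof -
  have "two_dyads 1 a b (-1) e f \<in> L"
  proof (rule two_dyads_in_L)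
    fix k :: nat
    have "real k ^ (a + b) = real k ^ e * real k ^ f"
      using assms by (simp add: power_add)
    then show "2 * 1 * real k ^ (a + b) + 2 * (- 1) * power_vec e k * real k ^ f
        = (if e = 0 then - 1 * real k ^ f else 0)"
      using assms by (simp add: power_vec_pos)
  qed (use assms in auto)
  from orth_L_two_dyads[OF this] show ?thesis using orth_L_00 by simp
qed

text \<open>The diagonal \<open>2 * real k ^ (a + b)\<close> of the first dyad is balanced by a
  border dyad with coefficient 2.\<close>

lemma orth_L_border:
  assumes "0 < a" "0 < b" "a + b \<le> r"
  shows "G W a b = - 2 * G W 0 (a + b)"
proof -
  have "two_dyads 1 a b 2 0 (a + b) \<in> L"
    by (rule two_dyads_in_L) (use assms in auto)
  from orth_L_two_dyads[OF this] show ?thesis using orth_L_00 by simp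
qed

text \<open>The entries of the reduced matrix depend only on the index sum, and the vanishing corner
  kills the low sums; positive semidefiniteness then propagates zeros from the diagonal entry
  with the smaller index sum \<open>2 * (a + b - q)\<close> to the whole row, up to index sum \<open>2 * q - 1\<close>.\<close>

lemma orth_L_block_zero:
  assumes q: "1 \<le> q" "q \<le> r"
    and nonneg: "\<And>c. 0 \<le> bform p W (\<lambda>i. \<Sum>a\<le>q. c a * power_vec a i) (\<lambda>i. \<Sum>a\<le>q. c a * power_vec a i)"
    and ab: "a < q" "b < q"
  shows "G W a b = 0"
proof -
  have iso: "G W a b = 0" if ab: "a \<le> q" "b \<le> q" and z: "G W a a = 0" for a b
  proof (rule bform_isotropic[OF orth_L_sym z])
    fix t
    \<comment> \<open>The coefficients are a sum of two indicators, so that the case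
      \<open>a = b\<close> is covered as well.\<close>
    have "(\<lambda>i. \<Sum>x\<le>q. ((if x = b then 1 else 0) + (if x = a then t else 0)) * power_vec x i)
        = (\<lambda>i. power_vec b i + t * power_vec a i)"
      using ab by (simp add: distrib_right sum.distrib if_distrib[of "\<lambda>c. c * _"] cong: if_cong)
    then show "0 \<le> bform p W (\<lambda>i. power_vec b i + t * power_vec a i)
        (\<lambda>i. power_vec b i + t * power_vec a i)"
      using nonneg[of "\<lambda>x. (if x = b then 1 else 0) + (if x = a then t else 0)"] by simp
  qed
  have border: "G W 0 t = 0" if "t \<le> q" for t
    using iso[of 0 t] that orth_L_00 by simp
  have inner: "G W a b = 0" if "0 < a" "0 < b" "a \<le> q" "b \<le> q" "a + b < 2 * q" for a b
    using that
  proof (induction "a + b" arbitrary: a b rule: less_induct)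
    case less
    show ?case
    proof (cases "a + b \<le> q")
      case True
      then show ?thesis using less.prems orth_L_border[of a b] border[of "a + b"] q by simp
    next
      case False
      \<comment> \<open>Since \<open>a + b < 2 * q\<close>, the sum \<open>2 * d\<close> is smaller
        than \<open>a + b\<close>, so the induction hypothesis reaches the diagonal entry at
        \<open>d\<close>.\<close>
      define d where "d = a + b - q"
      have d: "0 < d" "d < q" "a + b = d + q" using False less.prems by (auto simp: d_def)
      have "G W d d = 0" using less.hyps[of d d] d by simp
      then have "G W d q = 0" using iso d by simp
      then show ?thesis using orth_L_hankel[of a b d q] less.prems d q by simp
    qed
  qed
  show ?thesis
  proof (cases "a = 0 \<or> b = 0")
    case True
    then show ?thesis
      using border ab bform_commute[OF orth_L_sym, of "power_vec a" "power_vec 0"] by auto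
  next
    case False
    then show ?thesis using inner ab by simp
  qed
qed

end

text \<open>With \<open>q = r - j\<close>, the squares of span(v_0, ..., v_q) in \<open>F j\<close>
  make the next \<open>W\<close> nonnegative on that span. Hence \<open>W\<close> vanishes on
  span(v_0, ..., v_(q-1)), whose squares survive the cut.\<close>

lemma reduction_keeps_span:
  assumes F0: "F 0 = psd_cone p"
    and step: "\<And>j. 1 \<le> j \<Longrightarrow> j \<le> d \<Longrightarrow>
      W j \<in> orth p L \<inter> dual_cone p (F (j - 1)) \<and> F j = F (j - 1) \<inter> orth p {W j}"
    and d: "j \<le> d" "j \<le> r"
  shows "rank_one p (\<lambda>i. \<Sum>a\<le>r - j. c a * power_vec a i) \<in> F j"
  using d
proof (induction j arbitrary: c)
  case 0
  then show ?case by (simp add: F0 rank_one_psd)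
next
  case (Suc j)
  define q where "q = r - j"
  have q: "1 \<le> q" "q \<le> r" "r - Suc j = q - 1" using Suc.prems by (auto simp: q_def)
  have WL: "W (Suc j) \<in> orth p L" and Wd: "W (Suc j) \<in> dual_cone p (F j)"
    and F: "F (Suc j) = F j \<inter> orth p {W (Suc j)}"
    using step[of "Suc j"] Suc.prems by auto
  have Ws: "W (Suc j) \<in> sym_mats p" using WL by (simp add: orth_def)
  have Wc: "W (Suc j) \<in> carrier_mat p p" using Ws by (rule sym_mats_carrier)
  have IH: "rank_one p (\<lambda>i. \<Sum>a\<le>q. c a * power_vec a i) \<in> F j" for c
    using Suc by (simp add: q_def)
  have nonneg: "0 \<le> bform p (W (Suc j)) (\<lambda>i. \<Sum>a\<le>q. c a * power_vec a i) (\<lambda>i. \<Sum>a\<le>q. c a * power_vec a i)" for c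
    using Wd IH[of c] mat_inner_rank_one[OF Wc, symmetric] by (simp add: dual_cone_def)
  have zero: "G (W (Suc j)) a b = 0" if "a < q" "b < q" for a b
    using orth_L_block_zero[OF WL q(1,2) nonneg that] .
  let ?u = "\<lambda>i. \<Sum>a\<le>q - 1. c a * power_vec a i"
  have "rank_one p ?u \<in> F j"
  proof -
    \<comment> \<open>Padding with the coefficient 0 at \<open>q\<close> makes the induction
      hypothesis applicable.\<close>
    have "?u = (\<lambda>i. \<Sum>a\<le>q. (if a = q then 0 else c a) * power_vec a i)"
    proof
      fix i
      obtain q' where q': "q = Suc q'" using q(1) by (cases q) auto
      show "?u i = (\<Sum>a\<le>q. (if a = q then 0 else c a) * power_vec a i)"
        unfolding q' by (auto intro!: sum.cong)
    qed
    then show ?thesis using IH by simp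
  qed
  moreover have "bform p (W (Suc j)) ?u ?u = 0"
    unfolding bform_sum_left bform_sum_right[OF Ws]
    using q(1) by (intro sum.neutral ballI) (simp add: zero)
  then have "rank_one p ?u \<in> orth p {W (Suc j)}"
    using mat_inner_rank_one[OF Wc, of ?u] rank_one_psd[of p ?u]
      mat_inner_commute[OF Wc, of "rank_one p ?u"]
    by (auto simp: orth_def psd_cone_sym sym_mats_carrier)
  ultimately show ?case using F q(3) by simp
qed

subsection \<open>The upper bound\<close>

text \<open>For \<open>k > 0\<close>, this is the factor of R_ab k^(a+b) in Y_kk - (Y_0k + Y_k0) /
  2. Averaging the two borders makes it symmetric.\<close>

definition weight :: "nat \<Rightarrow> nat \<Rightarrow> real" where
  "weight a b = (if a = 0 \<and> b = 0 then 0 else if a = 0 \<or> b = 0 then - 1 / 2 else 1)"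

lemma weight_commute: "weight a b = weight b a"
  by (auto simp: weight_def)

text \<open>On \<open>L\<close>, the condition \<open>Y $$ (k, k) = Y $$ (0, k)\<close> says that a polynomial of degree at most
  \<open>2 * r\<close> vanishes at \<open>k\<close>.  It vanishes at \<open>2 * r + 1\<close> points, so its coefficients, which are
  the weighted antidiagonal sums of the reduced matrix, are zero.\<close>

lemma antidiagonal_sum_zero:
  assumes Y: "Y \<in> L"
  shows "(\<Sum>a\<le>r. \<Sum>b\<le>r. weight a b * of_bool (a + b = t) * bform p Y (w a) (w b)) = 0"
proof -
  define R where "R a b = bform p Y (w a) (w b)" for a b
  define P where "P = (\<Sum>a\<le>r. \<Sum>b\<le>r. monom (weight a b * R a b) (a + b))"
  have Ys: "Y \<in> sym_mats p" using Y by (rule L_sym)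
  have expand: "Y $$ (i, j) = (\<Sum>a\<le>r. \<Sum>b\<le>r. power_vec a i * power_vec b j * R a b)"
    if "i < p" "j < p" for i j
    unfolding R_def using Y that by (intro matrix_expand[OF Ys]) (auto simp: L_def)
  have "poly P (real k) = 0" if "k \<le> 2 * r" for k
  proof (cases "k = 0")
    case True
    \<comment> \<open>\<open>P\<close> has no constant term, as the weight at \<open>(0, 0)\<close>
      is 0.\<close>
    show ?thesis unfolding P_def poly_sum poly_monom
      using True by (intro sum.neutral ballI) (auto simp: weight_def)
  next
    case False
    \<comment> \<open>From \<open>2 * r \<le> n\<close>, each such \<open>k\<close> is an index at
      which \<open>L\<close> imposes a diagonal condition.\<close>
    have k: "k < p" "0 < p" "k \<in> {1..n}" using that False size by (auto simp: p_eq)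
    have "poly P (real k) = (\<Sum>a\<le>r. \<Sum>b\<le>r. power_vec a k * power_vec b k * R a b
        - (power_vec a 0 * power_vec b k * R a b + power_vec a k * power_vec b 0 * R a b) / 2)"
      unfolding P_def poly_sum poly_monom
      using False by (intro sum.cong refl) (auto simp: weight_def power_vec_pos power_add)
    also have "\<dots> = Y $$ (k, k) - (Y $$ (0, k) + Y $$ (k, 0)) / 2"
      by (simp only: sum_subtractf sum_divide_distrib[symmetric] sum.distrib expand[OF k(1,1)]
          expand[OF k(2,1)] expand[OF k(1,2)])
    also have "\<dots> = 0"
      using Y k sym_mats_index[OF Ys k(1,2)] by (simp add: L_def)
    finally show ?thesis .
  qed
  moreover have "degree P \<le> 2 * r"
    unfolding P_def
    by (intro degree_sum_le) (auto intro!: order.trans[OF degree_monom_le])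
  ultimately have "P = 0" by (intro poly_zero_if_many_roots[of P "2 * r"])
  then have "coeff P t = 0" by simp
  moreover have "coeff P t = (\<Sum>a\<le>r. \<Sum>b\<le>r. weight a b * of_bool (a + b = t) * R a b)"
    unfolding P_def coeff_sum by (intro sum.cong refl) simp
  ultimately show ?thesis by (simp add: R_def)
qed

text \<open>The weighted antidiagonal sum of index \<open>2 * (Suc r - j)\<close>, written as a
  matrix. The first certificate also carries the squares of the rows \<open>\<alpha> l\<close>:
  forcing the range of \<open>Y\<close> into the kernel then costs no step of its own.\<close>

definition cert :: "nat \<Rightarrow> real mat" where
  "cert j = fmat p (\<lambda>i k.
      (\<Sum>a\<le>r. \<Sum>b\<le>r. weight a b * of_bool (a + b = 2 * (Suc r - j)) * w a i * w b k)
      + (\<Sum>l<m. of_bool (j = 1) * \<alpha> l i * \<alpha> l k))"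

lemma cert_sym: "cert j \<in> sym_mats p"
  unfolding cert_def
proof (rule fmat_sym)
  fix i k
  show "(\<Sum>a\<le>r. \<Sum>b\<le>r. weight a b * of_bool (a + b = 2 * (Suc r - j)) * w a i * w b k)
      + (\<Sum>l<m. of_bool (j = 1) * \<alpha> l i * \<alpha> l k)
    = (\<Sum>a\<le>r. \<Sum>b\<le>r. weight a b * of_bool (a + b = 2 * (Suc r - j)) * w a k * w b i)
      + (\<Sum>l<m. of_bool (j = 1) * \<alpha> l k * \<alpha> l i)"
    by (subst sum.swap) (simp add: weight_commute add.commute mult_ac)
qed

lemma mat_inner_cert:
  assumes Y: "Y \<in> sym_mats p"
  shows "mat_inner (cert j) Y
    = (\<Sum>a\<le>r. \<Sum>b\<le>r. weight a b * of_bool (a + b = 2 * (Suc r - j)) * bform p Y (w a) (w b))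
      + of_bool (j = 1) * (\<Sum>l<m. bform p Y (\<alpha> l) (\<alpha> l))"
proof -
  have Yc: "Y \<in> carrier_mat p p" using Y by (rule sym_mats_carrier)
  show ?thesis
    unfolding cert_def mat_inner_fmat_add[OF Yc] mat_inner_fmat_dyads[OF Yc] sum.cartesian_product
      sum_distrib_left
    using mat_inner_fmat_dyads[OF Yc, where S = "{..r} \<times> {..r}" and x = "\<lambda>s. w (fst s)"
        and y = "\<lambda>s. w (snd s)"
        and g = "\<lambda>s. weight (fst s) (snd s) * of_bool (fst s + snd s = 2 * (Suc r - j))"]
    by (simp add: case_prod_beta bform_commute[OF Y, of "w (snd _)"])
qed

lemma bform_alpha_L: "Y \<in> L \<Longrightarrow> l < m \<Longrightarrow> bform p Y (\<alpha> l) x = 0"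
proof -
  assume "Y \<in> L" "l < m"
  then have z: "(\<Sum>i<p. \<alpha> l i * Y $$ (i, j)) = 0" if "j < p" for j
    using that by (simp add: L_def)
  have "bform p Y (\<alpha> l) x = (\<Sum>j<p. (\<Sum>i<p. \<alpha> l i * Y $$ (i, j)) * x j)"
    unfolding bform_def sum_distrib_right by (rule sum.swap)
  then show ?thesis by (simp add: z)
qed

lemma cert_orth_L: "cert j \<in> orth p L"
  using cert_sym mat_inner_cert L_sym antidiagonal_sum_zero bform_alpha_L by (simp add: orth_def)

text \<open>Vectors that the first \<open>j\<close> certificates make isotropic. The guard
  \<open>0 < j\<close> leaves this set empty at the start, where the face is the whole cone.\<close>

definition tests :: "nat \<Rightarrow> (nat \<Rightarrow> real) set" where
  "tests j = {\<alpha> l |l. 0 < j \<and> l < m} \<union> {w a |a. r - j < a \<and> a \<le> r}"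

definition face :: "nat \<Rightarrow> real mat set" where
  "face j = {Y \<in> psd_cone p. \<forall>x\<in>tests j. bform p Y x x = 0}"

lemma face_0: "face 0 = psd_cone p"
  by (auto simp: face_def tests_def)

text \<open>Put \<open>q = Suc r - j\<close>. On this face all R_ab with an index above
  \<open>q\<close> vanish, and on the antidiagonal of index \<open>2 * q\<close> every position
  other than \<open>(q, q)\<close> has such an index.\<close>

lemma mat_inner_cert_face:
  assumes j: "1 \<le> j" "j \<le> r" and Y: "Y \<in> face (j - 1)"
  shows "mat_inner (cert j) Y = bform p Y (w (Suc r - j)) (w (Suc r - j))
      + of_bool (j = 1) * (\<Sum>l<m. bform p Y (\<alpha> l) (\<alpha> l))"
proof -
  define q where "q = Suc r - j"
  have q: "0 < q" "q \<le> r" "r - (j - 1) = q" using j by (auto simp: q_def)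
  have Yp: "Y \<in> psd_cone p" using Y by (simp add: face_def)
  have z: "bform p Y (w a) (w b) = 0" if "q < a \<or> q < b" "a \<le> r" "b \<le> r" for a b
  proof -
    have "bform p Y (w c) (w c) = 0" if "q < c" "c \<le> r" for c
      using Y that unfolding face_def tests_def q(3) by blast
    then show ?thesis using that psd_isotropic[OF Yp] by blast
  qed
  have "(\<Sum>a\<le>r. \<Sum>b\<le>r. weight a b * of_bool (a + b = 2 * q) * bform p Y (w a) (w b))
      = (\<Sum>a\<le>r. \<Sum>b\<le>r. if b = q then (if a = q then bform p Y (w q) (w q) else 0) else 0)"
  proof (intro sum.cong refl)
    fix a b assume "a \<in> {..r}" "b \<in> {..r}"
    moreover have "q < a \<or> q < b \<or> a + b \<noteq> 2 * q \<or> (a = q \<and> b = q)" by linarith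
    ultimately show "weight a b * of_bool (a + b = 2 * q) * bform p Y (w a) (w b)
        = (if b = q then (if a = q then bform p Y (w q) (w q) else 0) else 0)"
      using z[of a b] q by (auto simp: weight_def)
  qed
  also have "\<dots> = bform p Y (w q) (w q)" using q by simp
  finally show ?thesis
    using mat_inner_cert[OF psd_cone_sym[OF Yp], of j] by (simp add: q_def)
qed

lemma tests_step:
  assumes "1 \<le> j" "j \<le> r"
  shows "tests j = tests (j - 1) \<union> {w (Suc r - j)} \<union> {\<alpha> l |l. j = 1 \<and> l < m}"
proof -
  have idx: "(r - j < a \<and> a \<le> r) \<longleftrightarrow> (r - (j - 1) < a \<and> a \<le> r) \<or> a = Suc r - j" for a
    using assms by auto
  have "{w a |a. r - j < a \<and> a \<le> r} = {w a |a. r - (j - 1) < a \<and> a \<le> r} \<union> {w (Suc r - j)}"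
    unfolding idx by blast
  moreover have "0 < j \<and> l < m \<longleftrightarrow> 0 < j - 1 \<and> l < m \<or> j = 1 \<and> l < m" for l
    using assms by auto
  then have "{\<alpha> l |l. 0 < j \<and> l < m}
      = {\<alpha> l |l. 0 < j - 1 \<and> l < m} \<union> {\<alpha> l |l. j = 1 \<and> l < m}"
    by blast
  ultimately show ?thesis unfolding tests_def by blast
qed

lemma cert_dual_face:
  assumes "1 \<le> j" "j \<le> r"
  shows "cert j \<in> dual_cone p (face (j - 1))"
proof -
  have "0 \<le> mat_inner (cert j) Y" if Y: "Y \<in> face (j - 1)" for Y
  proof -
    have "0 \<le> bform p Y x x" for x using Y by (simp add: face_def psd_cone_iff)
    then show ?thesis unfolding mat_inner_cert_face[OF assms Y] by (simp add: sum_nonneg)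
  qed
  then show ?thesis using cert_sym by (simp add: dual_cone_def)
qed

text \<open>On the previous face the certificate evaluates to a sum of nonnegative terms, one for
  each new test vector, so it vanishes exactly when all of them do.\<close>

lemma face_step:
  assumes j: "1 \<le> j" "j \<le> r"
  shows "face j = face (j - 1) \<inter> orth p {cert j}"
proof -
  have "(\<forall>x\<in>tests j. bform p Y x x = 0) \<longleftrightarrow> Y \<in> orth p {cert j}"
    if Y: "Y \<in> face (j - 1)" for Y
  proof -
    have Yp: "Y \<in> psd_cone p" and old: "\<forall>x\<in>tests (j - 1). bform p Y x x = 0"
      using Y by (auto simp: face_def)
    have nn: "0 \<le> bform p Y x x" for x using Yp by (simp add: psd_cone_iff)
    have "Y \<in> orth p {cert j} \<longleftrightarrow> mat_inner (cert j) Y = 0"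
      using Yp mat_inner_commute[of Y p "cert j"] sym_mats_carrier[OF cert_sym]
      by (auto simp: orth_def psd_cone_sym sym_mats_carrier)
    also have "\<dots> \<longleftrightarrow> bform p Y (w (Suc r - j)) (w (Suc r - j)) = 0 \<and>
        of_bool (j = 1) * (\<Sum>l<m. bform p Y (\<alpha> l) (\<alpha> l)) = 0"
      unfolding mat_inner_cert_face[OF j Y]
      by (intro add_nonneg_eq_0_iff nn mult_nonneg_nonneg sum_nonneg) auto
    also have "\<dots> \<longleftrightarrow> bform p Y (w (Suc r - j)) (w (Suc r - j)) = 0 \<and>
        (j = 1 \<longrightarrow> (\<forall>l<m. bform p Y (\<alpha> l) (\<alpha> l) = 0))"
      by (auto simp: sum_nonneg_eq_0_iff nn)
    also have "\<dots> \<longleftrightarrow> (\<forall>x\<in>tests j. bform p Y x x = 0)"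
      unfolding tests_step[OF j] using old by auto
    finally show ?thesis by blast
  qed
  moreover have "face j \<subseteq> face (j - 1)"
    unfolding face_def tests_step[OF j] by auto
  ultimately show ?thesis by (auto simp: face_def)
qed

lemma power_vec_in_face:
  assumes "b \<le> r - j"
  shows "rank_one p (power_vec b) \<in> face j"
  unfolding face_def tests_def
  using assms rank_one_psd by (auto simp: bform_rank_one dual kernel)

text \<open>The square of v_q with \<open>q = Suc r - j\<close> is still in the previous face and
  pairs with the certificate to 1.\<close>

lemma cert_not_orth_face:
  assumes j: "1 \<le> j" "j \<le> r"
  shows "cert j \<notin> orth p (face (j - 1))"
proof
  let ?q = "Suc r - j"
  assume "cert j \<in> orth p (face (j - 1))"
  moreover have mem: "rank_one p (power_vec ?q) \<in> face (j - 1)"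
    using j by (intro power_vec_in_face) auto
  ultimately have "mat_inner (cert j) (rank_one p (power_vec ?q)) = 0"
    by (simp add: orth_def)
  then show False
    unfolding mat_inner_cert_face[OF j mem] bform_rank_one
    using j by (simp add: dual kernel)
qed

lemma L_psd_subset_face: "j \<le> r \<Longrightarrow> L \<inter> psd_cone p \<subseteq> face j"
proof (induction j)
  case 0
  then show ?case by (simp add: face_0)
next
  case (Suc j)
  have "Y \<in> orth p {cert (Suc j)}" if "Y \<in> L" for Y
    using cert_orth_L[of "Suc j"] L_sym[OF that] that
      mat_inner_commute[of Y p "cert (Suc j)"] sym_mats_carrier[OF cert_sym]
    by (auto simp: orth_def sym_mats_carrier)
  then show ?case using Suc face_step[of "Suc j"] by auto
qed

section \<open>The minimal face and the exact length\<close>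

lemma face_is_face: "mat_face_of (face j) (psd_cone p)"
  unfolding face_def by (rule isotropic_face)

text \<open>All of \<open>w 1\<close>, ..., \<open>w r\<close> are isotropic, so only the term with
  both indices 0 remains in the expansion of \<open>Y\<close>.\<close>

lemma face_r_ray:
  assumes "Y \<in> face r"
  obtains c where "0 \<le> c" "Y = c \<cdot>\<^sub>m rank_one p (power_vec 0)"
proof
  have Yp: "Y \<in> psd_cone p" using assms by (simp add: face_def)
  then have Ys: "Y \<in> sym_mats p" by (rule psd_cone_sym)
  show "0 \<le> bform p Y (w 0) (w 0)" using Yp by (simp add: psd_cone_iff)
  have iso: "bform p Y x y = 0" "bform p Y y x = 0" if "x \<in> tests r" for x y
  proof -
    have "bform p Y x x = 0" using assms that by (simp add: face_def)
    then show "bform p Y x y = 0" "bform p Y y x = 0" by (rule psd_isotropic[OF Yp])+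
  qed
  show "Y = bform p Y (w 0) (w 0) \<cdot>\<^sub>m rank_one p (power_vec 0)"
  proof (rule eq_matI)
    fix i j
    assume "i < dim_row (bform p Y (w 0) (w 0) \<cdot>\<^sub>m rank_one p (power_vec 0))"
      and "j < dim_col (bform p Y (w 0) (w 0) \<cdot>\<^sub>m rank_one p (power_vec 0))"
    then have ij: "i < p" "j < p" by (auto simp: rank_one_def fmat_def)
    \<comment> \<open>Isotropy of \<open>\<alpha> l\<close>, paired with unit vectors, recovers the
      kernel equations; \<open>r_pos\<close> ensures that \<open>\<alpha> l\<close> is among the
      tests.\<close>
    have ker: "(\<Sum>k<p. \<alpha> l k * Y $$ (k, j)) = 0" if "l < m" "j < p" for l j
      using iso(1)[of "\<alpha> l" "\<lambda>k. of_bool (k = j)"] that r_pos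
      by (auto simp: bform_unit_right tests_def)
    have "Y $$ (i, j) = (\<Sum>a\<le>r. \<Sum>b\<le>r. power_vec a i * power_vec b j * bform p Y (w a) (w b))"
      by (rule matrix_expand[OF Ys ker ij])
    also have "\<dots> = (\<Sum>a\<le>r. \<Sum>b\<le>r. if b = 0 then (if a = 0 then
        power_vec 0 i * power_vec 0 j * bform p Y (w 0) (w 0) else 0) else 0)"
    proof (intro sum.cong refl)
      fix a b assume ab: "a \<in> {..r}" "b \<in> {..r}"
      have "bform p Y (w a) (w b) = 0" if "a \<noteq> 0 \<or> b \<noteq> 0"
        using that
      proof
        assume "a \<noteq> 0"
        then show ?thesis using ab by (intro iso(1)) (auto simp: tests_def)
      next
        assume "b \<noteq> 0"
        then show ?thesis using ab by (intro iso(2)) (auto simp: tests_def)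
      qed
      then show "power_vec a i * power_vec b j * bform p Y (w a) (w b)
          = (if b = 0 then (if a = 0 then
              power_vec 0 i * power_vec 0 j * bform p Y (w 0) (w 0) else 0) else 0)"
        by (cases "a = 0 \<and> b = 0") (auto)
    qed
    also have "\<dots> = power_vec 0 i * power_vec 0 j * bform p Y (w 0) (w 0)" by simp
    finally show "Y $$ (i, j) = (bform p Y (w 0) (w 0) \<cdot>\<^sub>m rank_one p (power_vec 0)) $$ (i, j)"
      using ij by (simp add: rank_one_def fmat_def)
  qed (use Ys in \<open>auto simp: sym_mats_def rank_one_def fmat_def\<close>)
qed

text \<open>Any face containing the feasible set contains e_0 e_0^T and hence its ray, which by
  \<open>face_r_ray\<close> exhausts \<open>face r\<close>.\<close>

lemma face_r_min: "face r = min_face p L"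
proof
  show "min_face p L \<subseteq> face r"
    unfolding min_face_def using face_is_face L_psd_subset_face[of r] by blast
  show "face r \<subseteq> min_face p L"
  proof
    fix Y assume "Y \<in> face r"
    then obtain c where c: "0 \<le> c" "Y = c \<cdot>\<^sub>m rank_one p (power_vec 0)" by (rule face_r_ray)
    have "Y \<in> F" if "mat_face_of F (psd_cone p)" "L \<inter> psd_cone p \<subseteq> F" for F
      unfolding c(2) using that rank_one_e0_in_L rank_one_psd c(1) by (intro face_contains_ray) auto
    then show "Y \<in> min_face p L" by (simp add: min_face_def)
  qed
qed

lemma facial_reduction_seq_face: "facial_reduction_seq p L r face cert"
  unfolding facial_reduction_seq_def
proof (intro conjI ballI)
  fix j assume "j \<in> {1..r}"
  then have j: "1 \<le> j" "j \<le> r" by auto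
  show "cert j \<in> orth p L \<inter> (dual_cone p (face (j - 1)) - orth p (face (j - 1)))"
    using cert_orth_L cert_dual_face[OF j] cert_not_orth_face[OF j] by blast
  show "face j = face (j - 1) \<inter> orth p {cert j}" using j by (rule face_step)
qed (use face_0 face_is_face face_r_min in auto)

text \<open>After fewer than \<open>r\<close> steps the square of v_1 is still present, but the
  minimal face excludes it because \<open>w 1\<close> pairs with v_1 to 1.\<close>

lemma facial_reduction_seq_length:
  assumes "facial_reduction_seq p L d F W"
  shows "r \<le> d"
proof (rule ccontr)
  assume "\<not> r \<le> d"
  then have d: "d < r" by simp
  have F0: "F 0 = psd_cone p" and Fd: "F d = min_face p L"
    and step: "\<And>j. j \<in> {1..d} \<Longrightarrow> W j \<in> orth p L \<inter> (dual_cone p (F (j - 1)) - orth p (F (j - 1)))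
      \<and> F j = F (j - 1) \<inter> orth p {W j}"
    using assms unfolding facial_reduction_seq_def by blast+
  have "rank_one p (\<lambda>i. \<Sum>a\<le>r - d. (if a = 1 then 1 else 0) * power_vec a i) \<in> F d"
  proof (rule reduction_keeps_span[where F = F and W = W and d = d, OF F0])
    fix j assume "1 \<le> j" "j \<le> d"
    then have "j \<in> {1..d}" by simp
    from step[OF this] show "W j \<in> orth p L \<inter> dual_cone p (F (j - 1)) \<and> F j = F (j - 1) \<inter> orth p {W j}"
      by blast
  qed (use d in auto)
  also have "(\<lambda>i. \<Sum>a\<le>r - d. (if a = 1 then 1 else 0) * power_vec a i) = power_vec 1"
    using d by (simp add: if_distrib[of "\<lambda>c. c * _"] Suc_le_eq cong: if_cong)
  also have "F d = face r" using Fd face_r_min by simp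
  finally have "\<forall>x\<in>tests r. bform p (rank_one p (power_vec 1)) x x = 0"
    by (simp add: face_def)
  moreover have "w 1 \<in> tests r" using r_pos by (auto simp: tests_def)
  ultimately have "bform p (rank_one p (power_vec 1)) (w 1) (w 1) = 0" by blast
  then show False using r_pos by (simp add: bform_rank_one dual)
qed

theorem singularity_degree_L: "singularity_degree p L = enat r"
  unfolding singularity_degree_def
proof (rule antisym)
  show "Inf {enat d |d. \<exists>F W. facial_reduction_seq p L d F W} \<le> enat r"
    using facial_reduction_seq_face by (intro Inf_lower) blast
  show "enat r \<le> Inf {enat d |d. \<exists>F W. facial_reduction_seq p L d F W}"
    using facial_reduction_seq_length by (intro Inf_greatest) auto
qed

end


section \<open>The relaxation as an instance\<close>

lemma sum_lessThan_add: "(\<Sum>k<r + m. f k) = (\<Sum>k<r. f k) + (\<Sum>k<m. f (r + k))"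
  for f :: "nat \<Rightarrow> real"
  by (induction m) (auto simp: add.assoc)

text \<open>\<open>D\<close> is the inverse of the top power matrix, and \<open>w a\<close> for
  \<open>a > 0\<close> is its row \<open>a - 1\<close>, shifted by one coordinate and padded with
  zeros. By \<open>alpha\<close>, a kernel vector has its last \<open>m\<close> entries determined
  by the first \<open>r\<close> after coordinate 0.\<close>

lemma power_kernel_intro:
  fixes n m r :: nat and D :: "nat \<Rightarrow> nat \<Rightarrow> real"
  assumes n: "n = r + m" and r: "0 < r" "r \<le> m"
    and left_inverse: "\<And>a b. a < r \<Longrightarrow> b < r \<Longrightarrow> (\<Sum>k<r. D a k * real (Suc k) ^ Suc b) = of_bool (a = b)"
    and right_inverse: "\<And>i j. i < r \<Longrightarrow> j < r \<Longrightarrow> (\<Sum>a<r. real (Suc i) ^ Suc a * D a j) = of_bool (i = j)"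
    and alpha: "\<And>l x. l < m \<Longrightarrow> (\<Sum>k<Suc n. \<alpha> l k * x k)
      = x (Suc (r + l)) - (\<Sum>a<r. real (Suc (r + l)) ^ Suc a * (\<Sum>k<r. D a k * x (Suc k)))"
  defines "w \<equiv> \<lambda>a k. if a = 0 then of_bool (k = 0) else if 0 < k \<and> k \<le> r then D (a - 1) (k - 1) else 0"
  shows "power_kernel n m r (Suc n) \<alpha> w"
proof
  show "2 * r \<le> n" "0 < r" "Suc n = Suc n" using n r by auto
  have w0: "(\<Sum>k<Suc n. w 0 k * x k) = x 0" for x
    by (subst sum.lessThan_Suc_shift) (simp add: w_def)
  have wS: "(\<Sum>k<Suc n. w (Suc a) k * x k) = (\<Sum>k<r. D a k * x (Suc k))" for a x
  proof -
    have "(\<Sum>k<Suc n. w (Suc a) k * x k) = (\<Sum>k<r + m. w (Suc a) (Suc k) * x (Suc k))"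
      by (subst sum.lessThan_Suc_shift) (simp add: w_def n)
    also have "\<dots> = (\<Sum>k<r. D a k * x (Suc k))"
      by (simp add: sum_lessThan_add w_def)
    finally show ?thesis .
  qed
  show "(\<Sum>k<Suc n. \<alpha> l k * power_vec a k) = 0" if "l < m" "a \<le> r" for l a
  proof (cases a)
    case (Suc b)
    \<comment> \<open>\<open>D\<close> maps the values of a power vector to a unit coefficient
      vector, so evaluation at \<open>Suc (r + l)\<close> reproduces the power itself.\<close>
    have "(\<Sum>t<r. real (Suc (r + l)) ^ Suc t * (\<Sum>k<r. D t k * real (Suc k) ^ Suc b))
        = (\<Sum>t<r. if t = b then real (Suc (r + l)) ^ Suc b else 0)"
      using that Suc by (intro sum.cong refl) (simp only: left_inverse lessThan_iff Suc_le_eq, simp)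
    then show ?thesis
      using that Suc unfolding alpha[OF that(1)] by (simp add: power_vec_pos)
  qed (use that in \<open>simp add: alpha del: sum.lessThan_Suc\<close>)
  show "(\<Sum>k<Suc n. w a k * power_vec b k) = of_bool (a = b)" if "a \<le> r" "b \<le> r" for a b
  proof (cases a)
    case 0
    then show ?thesis unfolding 0 w0 by simp
  next
    case (Suc a')
    show ?thesis
    proof (cases b)
      case 0
      then show ?thesis unfolding Suc wS by simp
    next
      case (Suc b')
      then show ?thesis
        using that \<open>a = Suc a'\<close> left_inverse[of a' b'] unfolding \<open>a = Suc a'\<close> wS
        by (simp add: power_vec_pos)
    qed
  qed
  fix x k
  assume ker: "\<And>l. l < m \<Longrightarrow> (\<Sum>k<Suc n. \<alpha> l k * x k) = 0" and k: "k < Suc n"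
  define y where "y a = (\<Sum>k<r. D a k * x (Suc k))" for a
  have sum: "(\<Sum>a\<le>r. power_vec a k * (\<Sum>i<Suc n. w a i * x i))
      = power_vec 0 k * x 0 + (\<Sum>a<r. power_vec (Suc a) k * y a)" for k
    unfolding lessThan_Suc_atMost[symmetric] sum.lessThan_Suc_shift[of _ r] w0 wS y_def ..
  show "x k = (\<Sum>a\<le>r. power_vec a k * (\<Sum>i<Suc n. w a i * x i))"
  proof (cases k)
    case 0
    then show ?thesis unfolding sum by simp
  next
    case (Suc i)
    have sum': "(\<Sum>a\<le>r. power_vec a k * (\<Sum>i<Suc n. w a i * x i))
        = (\<Sum>a<r. real (Suc i) ^ Suc a * y a)"
      unfolding sum Suc by (simp add: power_vec_pos)
    show ?thesis
    proof (cases "i < r")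
      case True
      \<comment> \<open>On the first \<open>r\<close> positive coordinates the coefficients
        \<open>y\<close> interpolate \<open>x\<close>, by the right inverse; the remaining
        coordinates use the kernel equations.\<close>
      have "(\<Sum>a<r. real (Suc i) ^ Suc a * y a)
          = (\<Sum>a<r. \<Sum>j<r. real (Suc i) ^ Suc a * D a j * x (Suc j))"
        unfolding y_def sum_distrib_left by (simp only: mult.assoc)
      also have "\<dots> = (\<Sum>j<r. (\<Sum>a<r. real (Suc i) ^ Suc a * D a j) * x (Suc j))"
        unfolding sum_distrib_right by (rule sum.swap)
      also have "\<dots> = (\<Sum>j<r. if j = i then x (Suc i) else 0)"
        using True by (intro sum.cong refl) (simp only: right_inverse lessThan_iff, simp)
      also have "\<dots> = x k" using True Suc by simp
      finally show ?thesis unfolding sum' by simp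
    next
      case False
      then obtain l where l: "i = r + l" using le_Suc_ex not_less by blast
      then have "l < m" using k Suc n by simp
      then show ?thesis using ker[of l] alpha[of l x] unfolding sum' by (simp add: Suc l y_def)
    qed
  qed
qed

text \<open>A kernel vector would be the coefficient list of a polynomial of degree at most
  \<open>r\<close> without constant term, vanishing at 0, 1, ..., \<open>r\<close>.\<close>

lemma power_matrix_det:
  "det (mat r r (\<lambda>(i, j). real (Suc i) ^ Suc j)) \<noteq> 0" (is "det ?C \<noteq> 0")
proof
  have C: "?C \<in> carrier_mat r r" by simp
  assume "det ?C = 0"
  then obtain v where v: "v \<in> carrier_vec r" "v \<noteq> 0\<^sub>v r" "?C *\<^sub>v v = 0\<^sub>v r"
    using det_0_iff_vec_prod_zero_field[OF C] by blast
  define P where "P = (\<Sum>j<r. monom (v $ j) (Suc j))"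
  have "poly P (real k) = 0" if "k \<le> r" for k
  proof (cases k)
    case 0
    then show ?thesis by (simp add: P_def poly_sum poly_monom)
  next
    case (Suc i)
    have "poly P (real k) = (?C *\<^sub>v v) $ i"
      using v(1) that Suc
      by (simp add: P_def poly_sum poly_monom scalar_prod_def lessThan_atLeast0 mult.commute)
    then show ?thesis unfolding v(3) using that Suc by simp
  qed
  moreover have "degree P \<le> r"
    unfolding P_def
    by (intro degree_sum_le) (auto intro!: order.trans[OF degree_monom_le])
  ultimately have "P = 0" by (intro poly_zero_if_many_roots[of P r])
  have "v $ i = 0" if "i < r" for i
  proof -
    have "coeff P (Suc i) = (\<Sum>j<r. if j = i then v $ i else 0)"
      unfolding P_def coeff_sum by (intro sum.cong refl) auto
    then show ?thesis using that \<open>P = 0\<close> by simp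
  qed
  then have "v = 0\<^sub>v r" using v(1) by (intro eq_vecI) auto
  then show False using v(2) by simp
qed

theorem proposition3:
  fixes n m r :: nat and C C_top C_bot A :: "real mat"
  assumes "n \<ge> 2"
    and "m = nat \<lceil>real n / 2\<rceil>"
    and "r = n - m"
    and "C = mat n r (\<lambda>(k, j). real (k + 1) ^ (j + 1))"
    and "C_top = mat r r (\<lambda>(i, j). C $$ (i, j))"
    and "C_bot = mat m r (\<lambda>(i, j). C $$ (n - m + i, j))"
    and "A = append_cols (- (C_bot * the (mat_inverse C_top))) (1\<^sub>m m)"
  shows "invertible_mat C_top \<and>
         singularity_degree (n + 1) (relaxation_affine A) = enat r \<and>
         r = nat \<lfloor>real n / 2\<rfloor>"
proof -
  have "\<lceil>real n / 2\<rceil> = int ((n + 1) div 2)"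
    by (rule ceiling_unique) linarith+
  then have m: "m = (n + 1) div 2" using assms(2) by simp
  have "r = n div 2" unfolding assms(3) m by linarith
  then have n: "n = r + m" and r: "0 < r" "r \<le> m" using assms(1) m by linarith+
  have "\<lfloor>real n / 2\<rfloor> = int (n div 2)"
    using floor_divide_of_nat_eq[of n 2] by simp
  then have floor: "r = nat \<lfloor>real n / 2\<rfloor>" using \<open>r = n div 2\<close> by simp
  have top: "C_top = mat r r (\<lambda>(i, j). real (Suc i) ^ Suc j)"
    unfolding assms(5) by (rule eq_matI) (use n in \<open>auto simp: assms(4)\<close>)
  have bot: "C_bot = mat m r (\<lambda>(i, j). real (Suc (r + i)) ^ Suc j)"
    unfolding assms(6) by (rule eq_matI) (use n in \<open>auto simp: assms(4)\<close>)
  have Ct: "C_top \<in> carrier_mat r r" by (simp add: top)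
  \<comment> \<open>Nonsingularity guarantees that \<open>the\<close> in the definition of
    \<open>A\<close> is applied to an actual inverse.\<close>
  have "C_top \<in> Units (ring_mat TYPE(real) r ())"
    using Ct power_matrix_det[of r] unfolding top by (rule det_non_zero_imp_unit)
  then have "mat_inverse C_top \<noteq> None" using mat_inverse(1)[OF Ct, where b = "()"] by blast
  then obtain D where D: "mat_inverse C_top = Some D" by blast
  then have inv: "C_top * D = 1\<^sub>m r" "D * C_top = 1\<^sub>m r" and Dc: "D \<in> carrier_mat r r"
    using mat_inverse(2)[OF Ct D] by auto
  have invertible: "invertible_mat C_top"
    using inv Ct Dc unfolding invertible_mat_def inverts_mat_def by auto
  have left: "(\<Sum>k<r. D $$ (a, k) * real (Suc k) ^ Suc b) = of_bool (a = b)" if "a < r" "b < r" for a b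
    using arg_cong[OF inv(2), of "\<lambda>M. M $$ (a, b)"] that Dc
    by (simp add: top scalar_prod_def lessThan_atLeast0)
  have right: "(\<Sum>a<r. real (Suc i) ^ Suc a * D $$ (a, j)) = of_bool (i = j)" if "i < r" "j < r" for i j
    using arg_cong[OF inv(1), of "\<lambda>M. M $$ (i, j)"] that Dc
    by (simp add: top scalar_prod_def lessThan_atLeast0)
  have A: "A \<in> carrier_mat m n"
    by (rule carrier_matI) (use Dc in \<open>simp_all add: assms(7) D append_cols_def bot n\<close>)
  have A_left: "A $$ (l, k) = - (\<Sum>a<r. real (Suc (r + l)) ^ Suc a * D $$ (a, k))"
    if "l < m" "k < r" for l k
    using that Dc by (simp add: assms(7) D append_cols_def bot scalar_prod_def lessThan_atLeast0)
  have A_right: "A $$ (l, r + k) = of_bool (k = l)" if "l < m" "k < m" for l k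
    using that Dc by (simp add: assms(7) D append_cols_def bot)
  \<comment> \<open>Row \<open>l\<close> of (0 A), with the zero column at index 0.\<close>
  define \<alpha> where "\<alpha> l k = (if k = 0 then 0 else A $$ (l, k - 1))" for l k
  have alpha_sum: "(\<Sum>k<Suc n. \<alpha> l k * x k) = (\<Sum>k<n. A $$ (l, k) * x (Suc k))" for l x
    by (subst sum.lessThan_Suc_shift) (simp add: \<alpha>_def)
  have alpha: "(\<Sum>k<Suc n. \<alpha> l k * x k)
      = x (Suc (r + l)) - (\<Sum>a<r. real (Suc (r + l)) ^ Suc a * (\<Sum>k<r. D $$ (a, k) * x (Suc k)))"
    if l: "l < m" for l x
  proof -
    have "(\<Sum>k<r. A $$ (l, k) * x (Suc k))
        = (\<Sum>k<r. \<Sum>a<r. - (real (Suc (r + l)) ^ Suc a * (D $$ (a, k) * x (Suc k))))"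
      using l by (intro sum.cong refl)
        (simp add: A_left sum_distrib_right sum_negf mult.assoc del: power_Suc of_nat_Suc)
    also have "\<dots> = (\<Sum>a<r. \<Sum>k<r. - (real (Suc (r + l)) ^ Suc a * (D $$ (a, k) * x (Suc k))))"
      by (rule sum.swap)
    also have "\<dots> = - (\<Sum>a<r. real (Suc (r + l)) ^ Suc a * (\<Sum>k<r. D $$ (a, k) * x (Suc k)))"
      by (simp only: sum_negf sum_distrib_left)
    finally have 1: "(\<Sum>k<r. A $$ (l, k) * x (Suc k))
        = - (\<Sum>a<r. real (Suc (r + l)) ^ Suc a * (\<Sum>k<r. D $$ (a, k) * x (Suc k)))" .
    have 2: "(\<Sum>k<m. A $$ (l, r + k) * x (Suc (r + k))) = (\<Sum>k<m. if k = l then x (Suc (r + l)) else 0)"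
      using l by (intro sum.cong refl) (simp add: A_right)
    show ?thesis
      unfolding alpha_sum unfolding n sum_lessThan_add 1 2 using l by simp
  qed
  define w where
    "w = (\<lambda>a k. if a = 0 then of_bool (k = 0) else if 0 < k \<and> k \<le> r then D $$ (a - 1, k - 1) else 0)"
  interpret power_kernel n m r "Suc n" \<alpha> w
    unfolding w_def using n r left right alpha by (rule power_kernel_intro)
  have "relaxation_affine A = L"
  proof -
    have "append_cols (0\<^sub>m m 1) A * Y = 0\<^sub>m m (n + 1) \<longleftrightarrow>
        (\<forall>l<m. \<forall>j<Suc n. (\<Sum>k<Suc n. \<alpha> l k * Y $$ (k, j)) = 0)" if Y: "Y \<in> sym_mats (Suc n)" for Y
    proof -
      have Yc: "Y \<in> carrier_mat (n + 1) (n + 1)" using sym_mats_carrier[OF Y] by simp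
      have "append_cols (0\<^sub>m m 1) A * Y \<in> carrier_mat m (n + 1)"
        by (rule carrier_matI) (use A Yc in \<open>simp_all add: append_cols_def\<close>)
      then have "append_cols (0\<^sub>m m 1) A * Y = 0\<^sub>m m (n + 1) \<longleftrightarrow>
          (\<forall>l<m. \<forall>j<n + 1. (append_cols (0\<^sub>m m 1) A * Y) $$ (l, j) = 0)"
        by (auto simp: mat_eq_iff)
      moreover have "(append_cols (0\<^sub>m m 1) A * Y) $$ (l, j) = (\<Sum>k<Suc n. \<alpha> l k * Y $$ (k, j))"
        if "l < m" "j < n + 1" for l j
        using append_cols_zero_mult[OF A Yc that] unfolding alpha_sum .
      ultimately show ?thesis by (simp del: sum.lessThan_Suc)
    qed
    then show ?thesis
      using A unfolding relaxation_affine_def L_def Let_def by auto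
  qed
  then show ?thesis using singularity_degree_L invertible floor by simp
qed

end
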